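(* In $\Lambda[[u^{-1},v^{-1}]]$ one has $$1+(u+v)\sum_{p,q=0}^\infty\frac{Fs_{(p\,|\,q)}}{(u-\tfrac12)\cdots(u-\tfrac{2p+1}2)\,(v-\tfrac12)\cdots(v-\tfrac{2q+1}2)}=H(u)\,E(v).$$ Equivalently, for all $p,q=0,1,2,\dots$, $$Fs_{(p+1\,|\,q)}+Fs_{(p\,|\,q+1)}+(p+q+1)\,Fs_{(p\,|\,q)}=Fs_{(p\,|\,0)}\,Fs_{(0\,|\,q)}.$$
   Context: The base field is $\mathbb C$. $\Lambda=\mathbb C[\mathbf p_1,\mathbf p_2,\dots]$ is the algebra of symmetric functions (polynomial ring in the power sums). Its elements $h_k,e_k$ are defined by $H(u)=1+\sum_{k\ge1}h_ku^{-k}=\exp\big(\sum_{k\ge1}\mathbf p_ku^{-k}/k\big)$ and $E(u)=1+\sum_{k\ge1}e_ku^{-k}=H(-u)^{-1}$ in $\Lambda[[u^{-1}]]$. $(p\,|\,q)$ denotes the hook Young diagram $(p+1,1^q)$. Shifted symmetric functions: $\Lambda^*_n\subset\mathbb C[x_1,\dots,x_n]$ is the algebra of polynomials symmetric in the variables $x_j-j$, and $\Lambda^*=\varprojlim\Lambda^*_n$ is the projective limit in filtered algebras (filtration by degree) under the maps $x_n=0$. Put $x^{\downarrow m}=x(x-1)\cdots(x-m+1)$, $x^{\downarrow0}=1$. The shifted Schur function $s^*_\mu\in\Lambda^*$ is given for $n\ge\ell(\mu)$ by $$s^*_\mu(x_1,\dots,x_n)=\frac{\det[(x_i+n-i)^{\downarrow(\mu_j+n-j)}]_{i,j=1}^n}{\det[(x_i+n-i)^{\downarrow(n-j)}]_{i,j=1}^n}$$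 (these are compatible for varying $n$). Put $h^*_k=s^*_{(k)}$ and $H^*(u)=1+\sum_{k\ge1}h^*_k/u^{\downarrow k}\in\Lambda^*[[u^{-1}]]$. $\Lambda^*$ is the polynomial algebra in $h_1^*,h_2^*,\dots$, and $\varphi:\Lambda^*\to\Lambda$ is the algebra isomorphism defined (coefficientwise in $u^{-1}$) by $\varphi(H^*(u))=H(u+\tfrac12)$. The Frobenius--Schur function is $Fs_\mu=\varphi(s^*_\mu)$. *)

theory Defs
  imports
    "HOL-Library.Poly_Mapping"
    "HOL-Computational_Algebra.Formal_Laurent_Series"
    "Jordan_Normal_Form.Determinant"
begin

section \<open>Polynomials in countably many variables over the complex numbers\<close>

text \<open>
  Monomials are finitely supported exponent functions.  Variables are numbered from 0, so
  \<open>var i\<close> is $x_{i+1}$ when the type is read as a ring of polynomials in $x_1, x_2, \ldots$,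
  and $\mathbf p_{i+1}$ when it is read as the algebra $\Lambda$ of symmetric functions.
\<close>

type_synonym cpoly = "(nat \<Rightarrow>\<^sub>0 nat) \<Rightarrow>\<^sub>0 complex"

definition scal :: "complex \<Rightarrow> cpoly" where
  "scal c = Poly_Mapping.single 0 c"

definition var :: "nat \<Rightarrow> cpoly" where
  "var i = Poly_Mapping.single (Poly_Mapping.single i 1) 1"

definition polys_in :: "nat \<Rightarrow> cpoly set" where
  "polys_in n = {f. \<forall>m\<in>Poly_Mapping.keys f. Poly_Mapping.keys m \<subseteq> {..<n}}"

definition mon_deg :: "(nat \<Rightarrow>\<^sub>0 nat) \<Rightarrow> nat" where
  "mon_deg m = (\<Sum>i\<in>Poly_Mapping.keys m. Poly_Mapping.lookup m i)"

definition deg_le :: "nat \<Rightarrow> cpoly \<Rightarrow> bool" where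
  "deg_le d f \<longleftrightarrow> (\<forall>m\<in>Poly_Mapping.keys f. mon_deg m \<le> d)"

definition mon_subst :: "(nat \<Rightarrow> cpoly) \<Rightarrow> (nat \<Rightarrow>\<^sub>0 nat) \<Rightarrow> cpoly" where
  "mon_subst g m = (\<Prod>i\<in>Poly_Mapping.keys m. g i ^ Poly_Mapping.lookup m i)"

definition subst :: "(nat \<Rightarrow> cpoly) \<Rightarrow> cpoly \<Rightarrow> cpoly" where
  "subst g f = (\<Sum>m\<in>Poly_Mapping.keys f. scal (Poly_Mapping.lookup f m) * mon_subst g m)"

lemma scal_0 [simp]: "scal 0 = 0"
  and scal_1 [simp]: "scal 1 = 1"
  and scal_add: "scal (a + b) = scal a + scal b"
  and scal_mult: "scal (a * b) = scal a * scal b"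
  by (simp_all add: scal_def single_add mult_single)

lemma mon_subst_superset:
  assumes "finite A" "Poly_Mapping.keys m \<subseteq> A"
  shows "mon_subst g m = (\<Prod>i\<in>A. g i ^ Poly_Mapping.lookup m i)"
  unfolding mon_subst_def using assms
  by (intro prod.mono_neutral_left) (auto simp: in_keys_iff)

lemma mon_subst_add: "mon_subst g (a + b) = mon_subst g a * mon_subst g b"
proof -
  let ?A = "Poly_Mapping.keys a \<union> Poly_Mapping.keys b"
  have "mon_subst g (a + b) = (\<Prod>i\<in>?A. g i ^ Poly_Mapping.lookup (a + b) i)"
    by (rule mon_subst_superset) (auto dest: subsetD [OF Poly_Mapping.keys_add])
  moreover have "mon_subst g a = (\<Prod>i\<in>?A. g i ^ Poly_Mapping.lookup a i)"
    "mon_subst g b = (\<Prod>i\<in>?A. g i ^ Poly_Mapping.lookup b i)"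
    by (rule mon_subst_superset; auto)+
  ultimately show ?thesis
    by (simp add: lookup_add power_add prod.distrib)
qed

lemma subst_superset:
  assumes "finite A" "Poly_Mapping.keys f \<subseteq> A"
  shows "subst g f = (\<Sum>m\<in>A. scal (Poly_Mapping.lookup f m) * mon_subst g m)"
  unfolding subst_def using assms
  by (intro sum.mono_neutral_left) (auto simp: in_keys_iff)

lemma subst_0 [simp]: "subst g 0 = 0"
  by (simp add: subst_def)

lemma subst_add: "subst g (f + h) = subst g f + subst g h"
proof -
  let ?A = "Poly_Mapping.keys f \<union> Poly_Mapping.keys h"
  have "subst g (f + h) = (\<Sum>m\<in>?A. scal (Poly_Mapping.lookup (f + h) m) * mon_subst g m)"
    by (rule subst_superset) (auto dest: subsetD [OF Poly_Mapping.keys_add])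
  moreover have "subst g f = (\<Sum>m\<in>?A. scal (Poly_Mapping.lookup f m) * mon_subst g m)"
    "subst g h = (\<Sum>m\<in>?A. scal (Poly_Mapping.lookup h m) * mon_subst g m)"
    by (rule subst_superset; auto)+
  ultimately show ?thesis
    by (simp add: lookup_add scal_add distrib_right sum.distrib)
qed

lemma subst_uminus: "subst g (- f) = - subst g f"
  using subst_add [of g f "- f"] by (simp add: eq_neg_iff_add_eq_0 add.commute)

lemma subst_single: "subst g (Poly_Mapping.single m c) = scal c * mon_subst g m"
  by (cases "c = 0") (auto simp: subst_def)

lemma subst_scal [simp]: "subst g (scal c) = scal c"
  unfolding scal_def [of c] subst_single by (simp add: mon_subst_def scal_def)

lemma subst_1 [simp]: "subst g 1 = 1"
  using subst_scal [of g 1] by simp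

lemma subst_sum: "subst g (\<Sum>i\<in>I. f i) = (\<Sum>i\<in>I. subst g (f i))"
  by (induction I rule: infinite_finite_induct) (auto simp: subst_add)

lemma cpoly_expand: "f = (\<Sum>m\<in>Poly_Mapping.keys f. Poly_Mapping.single m (Poly_Mapping.lookup f m))"
  for f :: cpoly
  by (rule poly_mapping_eqI) (auto simp: lookup_sum lookup_single when_def in_keys_iff)

lemma subst_mult: "subst g (f * h) = subst g f * subst g h"
proof -
  let ?l = Poly_Mapping.lookup and ?k = Poly_Mapping.keys
  have "f * h = (\<Sum>m\<in>?k f. \<Sum>m'\<in>?k h. Poly_Mapping.single (m + m') (?l f m * ?l h m'))"
    by (subst (1) cpoly_expand [of f], subst (1) cpoly_expand [of h])
      (simp add: sum_product mult_single)
  then have "subst g (f * h) =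
      (\<Sum>m\<in>?k f. \<Sum>m'\<in>?k h. scal (?l f m * ?l h m') * mon_subst g (m + m'))"
    by (simp add: subst_sum subst_single)
  also have "\<dots> = subst g f * subst g h"
    by (simp add: subst_def sum_product scal_mult mon_subst_add mult_ac)
  finally show ?thesis .
qed

lemma polys_in_closed:
  shows "scal c \<in> polys_in n"
    and "f \<in> polys_in n \<Longrightarrow> h \<in> polys_in n \<Longrightarrow> f + h \<in> polys_in n"
    and "f \<in> polys_in n \<Longrightarrow> h \<in> polys_in n \<Longrightarrow> f * h \<in> polys_in n"
    and "f \<in> polys_in n \<Longrightarrow> - f \<in> polys_in n"
proof -
  show "scal c \<in> polys_in n" by (auto simp: polys_in_def scal_def)
  show "f + h \<in> polys_in n" if "f \<in> polys_in n" "h \<in> polys_in n"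
    using that Poly_Mapping.keys_add [of f h] unfolding polys_in_def by blast
  show "- f \<in> polys_in n" if "f \<in> polys_in n"
    using that by (auto simp: polys_in_def in_keys_iff)
  show "f * h \<in> polys_in n" if "f \<in> polys_in n" "h \<in> polys_in n"
    unfolding polys_in_def
  proof (intro CollectI ballI)
    fix m assume "m \<in> Poly_Mapping.keys (f * h)"
    then obtain a b where "m = a + b" "a \<in> Poly_Mapping.keys f" "b \<in> Poly_Mapping.keys h"
      using keys_mult [of f h] by blast
    with that Poly_Mapping.keys_add [of a b] show "Poly_Mapping.keys m \<subseteq> {..<n}"
      unfolding polys_in_def by blast
  qed
qed

lemma mon_deg_superset:
  assumes "finite A" "Poly_Mapping.keys m \<subseteq> A"
  shows "mon_deg m = (\<Sum>i\<in>A. Poly_Mapping.lookup m i)"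
  unfolding mon_deg_def using assms
  by (intro sum.mono_neutral_left) (auto simp: in_keys_iff)

lemma mon_deg_add: "mon_deg (a + b) = mon_deg a + mon_deg b"
proof -
  let ?A = "Poly_Mapping.keys a \<union> Poly_Mapping.keys b"
  have "mon_deg (a + b) = (\<Sum>i\<in>?A. Poly_Mapping.lookup (a + b) i)"
    by (rule mon_deg_superset) (auto dest: subsetD [OF Poly_Mapping.keys_add])
  moreover have "mon_deg a = (\<Sum>i\<in>?A. Poly_Mapping.lookup a i)"
    "mon_deg b = (\<Sum>i\<in>?A. Poly_Mapping.lookup b i)"
    by (rule mon_deg_superset; auto)+
  ultimately show ?thesis
    by (simp add: lookup_add sum.distrib)
qed

lemma deg_le_closed:
  shows "deg_le 0 (scal c)"
    and "deg_le d f \<Longrightarrow> deg_le d' h \<Longrightarrow> deg_le (max d d') (f + h)"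
    and "deg_le d f \<Longrightarrow> deg_le d' h \<Longrightarrow> deg_le (d + d') (f * h)"
    and "deg_le d f \<Longrightarrow> deg_le d (- f)"
proof -
  show "deg_le 0 (scal c)" by (auto simp: deg_le_def scal_def mon_deg_def)
  show "deg_le (max d d') (f + h)" if "deg_le d f" "deg_le d' h"
    using that Poly_Mapping.keys_add [of f h] unfolding deg_le_def by (auto simp: le_max_iff_disj)
  show "deg_le d (- f)" if "deg_le d f"
    using that by (auto simp: deg_le_def in_keys_iff)
  show "deg_le (d + d') (f * h)" if "deg_le d f" "deg_le d' h"
    unfolding deg_le_def
  proof
    fix m assume "m \<in> Poly_Mapping.keys (f * h)"
    then obtain a b where "m = a + b" "a \<in> Poly_Mapping.keys f" "b \<in> Poly_Mapping.keys h"
      using keys_mult [of f h] by blast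
    with that show "mon_deg m \<le> d + d'"
      unfolding deg_le_def by (auto simp: mon_deg_add intro: add_mono)
  qed
qed


section \<open>Shifted symmetric functions\<close>

text \<open>
  Symmetry in the shifted variables $y_j = x_j - j$: permuting the $y_j$ by \<open>\<sigma>\<close> amounts to
  substituting $x_j \mapsto x_{\sigma(j)} - \sigma(j) + j$.
\<close>

definition shifted_perm :: "(nat \<Rightarrow> nat) \<Rightarrow> cpoly \<Rightarrow> cpoly" where
  "shifted_perm \<sigma> = subst (\<lambda>j. var (\<sigma> j) - of_nat (\<sigma> j + 1) + of_nat (j + 1))"

definition shifted_sym_polys :: "nat \<Rightarrow> cpoly set" where
  "shifted_sym_polys n =
     {f \<in> polys_in n. \<forall>\<sigma>. \<sigma> permutes {..<n} \<longrightarrow> shifted_perm \<sigma> f = f}"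

text \<open>The map from $n+1$ to $n$ variables setting $x_{n+1} = 0$.\<close>

definition restrict_last :: "nat \<Rightarrow> cpoly \<Rightarrow> cpoly" where
  "restrict_last n = subst (\<lambda>j. if j = n then 0 else var j)"

text \<open>
  The projective limit in the category of filtered algebras: compatible sequences of bounded
  degree. \<open>at_level F n\<close> is $F(x_1, \ldots, x_n)$.
\<close>

typedef shifted_sym =
  "{F :: nat \<Rightarrow> cpoly.
      (\<forall>n. F n \<in> shifted_sym_polys n) \<and>
      (\<forall>n. restrict_last n (F (Suc n)) = F n) \<and>
      (\<exists>d. \<forall>n. deg_le d (F n))}"
  morphisms at_level Abs_shifted_sym
  by (rule exI [of _ "\<lambda>_. scal 0"])
    (auto simp: shifted_sym_polys_def polys_in_def deg_le_def shifted_perm_def restrict_last_def)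

setup_lifting type_definition_shifted_sym

lift_definition shifted_scal :: "complex \<Rightarrow> shifted_sym" is "\<lambda>c n. scal c"
  using deg_le_closed(1)
  by (auto simp: shifted_sym_polys_def polys_in_closed shifted_perm_def restrict_last_def)

instantiation shifted_sym :: comm_ring_1
begin

lift_definition zero_shifted_sym :: shifted_sym is "\<lambda>n. 0"
  by (auto simp: shifted_sym_polys_def polys_in_def deg_le_def shifted_perm_def restrict_last_def)

lift_definition one_shifted_sym :: shifted_sym is "\<lambda>n. 1"
  using polys_in_closed(1) [of 1] deg_le_closed(1) [of 1]
  by (auto simp: shifted_sym_polys_def shifted_perm_def restrict_last_def)

lift_definition plus_shifted_sym :: "shifted_sym \<Rightarrow> shifted_sym \<Rightarrow> shifted_sym"
  is "\<lambda>F G n. F n + G n"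
  using deg_le_closed(2)
  by (auto simp: shifted_sym_polys_def polys_in_closed shifted_perm_def restrict_last_def subst_add)
    blast

lift_definition uminus_shifted_sym :: "shifted_sym \<Rightarrow> shifted_sym"
  is "\<lambda>F n. - F n"
  using deg_le_closed(4)
  by (auto simp: shifted_sym_polys_def polys_in_closed shifted_perm_def restrict_last_def
      subst_uminus)
    blast

lift_definition times_shifted_sym :: "shifted_sym \<Rightarrow> shifted_sym \<Rightarrow> shifted_sym"
  is "\<lambda>F G n. F n * G n"
  using deg_le_closed(3)
  by (auto simp: shifted_sym_polys_def polys_in_closed shifted_perm_def restrict_last_def subst_mult)
    blast

definition minus_shifted_sym :: "shifted_sym \<Rightarrow> shifted_sym \<Rightarrow> shifted_sym" where
  "minus_shifted_sym F G = F + - G"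

instance
  by standard
    (transfer; simp add: algebra_simps fun_eq_iff; fail |
     simp add: minus_shifted_sym_def)+

end

subsection \<open>Shifted Schur functions\<close>

definition falling :: "'a::comm_ring_1 \<Rightarrow> nat \<Rightarrow> 'a" where
  "falling x m = (\<Prod>i<m. x - of_nat i)"

text \<open>
  A Young diagram is the list of its nonzero row lengths, so \<open>length \<mu>\<close> is $\ell(\mu)$ and
  \<open>nth_default 0 \<mu> j\<close> is $\mu_{j+1}$. Matrix indices start at 0.
\<close>

definition shifted_alternant :: "nat \<Rightarrow> nat list \<Rightarrow> cpoly" where
  "shifted_alternant n \<mu> =
     det (mat n n (\<lambda>(i, j).
       falling (var i + of_nat n - of_nat (i + 1)) (nth_default 0 \<mu> j + n - (j + 1))))"

text \<open>
  \<open>shifted_schur \<mu>\<close> is the element of $\Lambda^*$ whose components for $n \ge \ell(\mu)$ are the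
  quotients of alternants; as the polynomial ring is a domain and the denominator is nonzero,
  the quotient is expressed by multiplying with the denominator.
\<close>

definition shifted_schur :: "nat list \<Rightarrow> shifted_sym" where
  "shifted_schur \<mu> =
     (THE F. \<forall>n \<ge> length \<mu>. at_level F n * shifted_alternant n [] = shifted_alternant n \<mu>)"

definition hook :: "nat \<Rightarrow> nat \<Rightarrow> nat list" where
  "hook p q = (p + 1) # replicate q 1"


section \<open>Generating series\<close>

text \<open>
  A series in $u^{-1}$ is a formal power series whose variable \<open>fps_X\<close> is $u^{-1}$.
  \<open>inv_lin c\<close> is the expansion $u^{-1} (1 - c u^{-1})^{-1}$ of $1/(u - c)$; the second argument
  of \<open>fps_right_inverse\<close> is the inverse of the constant coefficient.
\<close>

definition inv_lin :: "'a::comm_ring_1 \<Rightarrow> 'a fps" where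
  "inv_lin c = fps_X * fps_right_inverse (1 - fps_const c * fps_X) 1"

lemma inv_lin_correct: "(1 - fps_const c * fps_X) * inv_lin c = fps_X"
proof -
  have "(1 - fps_const c * fps_X) * fps_right_inverse (1 - fps_const c * fps_X) 1 = 1"
    by (rule fps_right_inverse) simp
  then show ?thesis
    unfolding inv_lin_def by (metis mult.left_commute mult.right_neutral)
qed

text \<open>$1/u^{\downarrow k} = 1/(u(u-1)\cdots(u-k+1))$\<close>

definition inv_falling :: "nat \<Rightarrow> 'a::comm_ring_1 fps" where
  "inv_falling k = (\<Prod>j<k. inv_lin (of_nat j))"

text \<open>The series $H(u)$ and $E(u)$ over $\Lambda$; here \<open>var (k - 1)\<close> is $\mathbf p_k$.\<close>

definition H_ser :: "cpoly fps" where
  "H_ser =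
     fps_compose (Abs_fps (\<lambda>n. scal (1 / fact n)))
       (Abs_fps (\<lambda>k. if k = 0 then 0 else scal (1 / of_nat k) * var (k - 1)))"

definition E_ser :: "cpoly fps" where
  "E_ser = fps_right_inverse (fps_compose H_ser (- fps_X)) 1"

text \<open>$H^*(u)$; the infinite sum converges in the topology of \<open>fps\<close>.\<close>

definition shifted_h :: "nat \<Rightarrow> shifted_sym" where
  "shifted_h k = shifted_schur [k]"

definition Hstar_ser :: "shifted_sym fps" where
  "Hstar_ser = 1 + suminf (\<lambda>k. fps_const (shifted_h (Suc k)) * inv_falling (Suc k))"


section \<open>Frobenius--Schur functions\<close>

definition algebra_iso :: "(shifted_sym \<Rightarrow> cpoly) \<Rightarrow> bool" where
  "algebra_iso \<phi> \<longleftrightarrow>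
     bij \<phi> \<and> (\<forall>F G. \<phi> (F + G) = \<phi> F + \<phi> G) \<and> (\<forall>F G. \<phi> (F * G) = \<phi> F * \<phi> G) \<and>
     (\<forall>c. \<phi> (shifted_scal c) = scal c)"

text \<open>
  $\varphi(H^*(u)) = H(u + \frac12)$, coefficientwise. As $\Lambda^*$ is the polynomial algebra
  in the $h^*_k$, exactly one map \<open>\<phi>\<close> satisfies this predicate; $H(u + \frac12)$ is obtained from $H$ by
  replacing $u^{-1}$ with the expansion of $1/(u + \frac12)$.
\<close>

definition frobenius_schur_iso :: "(shifted_sym \<Rightarrow> cpoly) \<Rightarrow> bool" where
  "frobenius_schur_iso \<phi> \<longleftrightarrow>
     algebra_iso \<phi> \<and>
     Abs_fps (\<lambda>n. \<phi> (fps_nth Hstar_ser n)) = fps_compose H_ser (inv_lin (scal (- 1 / 2)))"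

definition Fs :: "(shifted_sym \<Rightarrow> cpoly) \<Rightarrow> nat list \<Rightarrow> cpoly" where
  "Fs \<phi> \<mu> = \<phi> (shifted_schur \<mu>)"

text \<open>$1/((u-\frac12)(u-\frac32)\cdots(u-\frac{2p+1}2))$\<close>

definition inv_half_falling :: "nat \<Rightarrow> cpoly fps" where
  "inv_half_falling p = (\<Prod>j\<le>p. inv_lin (scal (of_nat (2 * j + 1) / 2)))"


section \<open>Series in two variables\<close>

text \<open>
  $R[[u^{-1}, v^{-1}]]$ is \<open>'a fps fps\<close>, with \<open>v\<inverse>\<close> the outer and \<open>u\<inverse>\<close> the inner variable.
  The library topology on \<open>'a fps fps\<close> treats the coefficients as discrete, so sums of doubly
  indexed families are taken coefficientwise instead.
\<close>

definition in_u :: "'a::zero fps \<Rightarrow> 'a fps fps" where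
  "in_u f = fps_const f"

definition in_v :: "'a::zero fps \<Rightarrow> 'a fps fps" where
  "in_v f = Abs_fps (\<lambda>j. fps_const (fps_nth f j))"

definition double_sum :: "(nat \<Rightarrow> nat \<Rightarrow> 'a::comm_monoid_add fps fps) \<Rightarrow> 'a fps fps" where
  "double_sum F =
     Abs_fps (\<lambda>j. Abs_fps (\<lambda>i. Sum_any (\<lambda>(p, q). fps_nth (fps_nth (F p q) j) i)))"

text \<open>
  The factor $u + v$ is not a power series in $u^{-1}, v^{-1}$, so the identity is stated inside
  the larger ring of iterated Laurent series.
\<close>

definition to_laurent :: "'a::zero fps fps \<Rightarrow> 'a fls fls" where
  "to_laurent f = fps_to_fls (Abs_fps (\<lambda>j. fps_to_fls (fps_nth f j)))"

lemma to_laurent_inject: "to_laurent f = to_laurent g \<longleftrightarrow> f = g"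
  by (auto simp: to_laurent_def fps_eq_iff)

definition u_var :: "'a::zero_neq_one fls fls" where
  "u_var = fls_const fls_X_inv"

definition v_var :: "'a::zero_neq_one fls fls" where
  "v_var = fls_X_inv"

definition hook_term :: "(shifted_sym \<Rightarrow> cpoly) \<Rightarrow> nat \<Rightarrow> nat \<Rightarrow> cpoly fps fps" where
  "hook_term \<phi> p q =
     fps_const (fps_const (Fs \<phi> (hook p q))) *
     in_u (inv_half_falling p) * in_v (inv_half_falling q)"

text \<open>The family \<open>hook_term \<phi>\<close> is locally finite, so \<open>double_sum\<close> is its genuine sum.\<close>

lemma inv_half_falling_nth_0: "i \<le> p \<Longrightarrow> fps_nth (inv_half_falling p) i = 0"
proof -
  assume "i \<le> p"
  have "inv_half_falling p = fps_X ^ Suc p *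
      (\<Prod>j\<le>p. fps_right_inverse (1 - fps_const (scal (of_nat (2 * j + 1) / 2)) * fps_X) 1)"
    by (simp add: inv_half_falling_def inv_lin_def prod.distrib)
  with \<open>i \<le> p\<close> show ?thesis
    by (simp only: fps_X_power_mult_nth) simp
qed

lemma hook_term_nth:
  "fps_nth (fps_nth (hook_term \<phi> p q) j) i =
     Fs \<phi> (hook p q) * fps_nth (inv_half_falling p) i * fps_nth (inv_half_falling q) j"
  by (simp add: hook_term_def in_u_def in_v_def mult.assoc)

lemma hook_term_locally_finite:
  "finite {(p, q). fps_nth (fps_nth (hook_term \<phi> p q) j) i \<noteq> 0}"
proof (rule finite_subset)
  show "{(p, q). fps_nth (fps_nth (hook_term \<phi> p q) j) i \<noteq> 0} \<subseteq> {..<i} \<times> {..<j}"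
    using inv_half_falling_nth_0 by (auto simp: hook_term_nth simp flip: not_le)
qed simp

end

theory Submission
  imports Defs
begin

text \<open>
  Both statements come from one Pieri rule for shifted Schur functions of hooks,
  $$s^*_{(p+1|q)} + s^*_{(p|q+1)} + (p+q+1)\, s^*_{(p|q)} = s^*_{(p|0)}\, s^*_{(0|q)},$$
  to which the algebra isomorphism \<open>\<phi>\<close> is applied.

  The Pieri rule is an identity of alternants. The product $\prod_i (u + x_i - i + 1)$ is, up to the
  factor $u^{\downarrow n}$, the generating function of the shifted elementary polynomials
  (\<open>shifted_e_poly_generating_function\<close>). Multiplying an alternant by it multiplies the rows by
  linear factors, which act on a column of falling powers by
  $(y - w)\, y^{\downarrow e} = y^{\downarrow (e+1)} + (e - w)\, y^{\downarrow e}$. In the determinant of a one-row diagram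
  almost all terms of the column expansion have two equal columns, and what remains are hooks
  (\<open>hook_alternant_generating_function\<close>). Comparing coefficients in \<open>u\<close> gives
  \<open>hook_alternant_pieri\<close>.

  A shifted Schur function is defined as the quotient of alternants, so it has to be shown that
  the quotient is an element of \<open>\<Lambda>\<^sup>*\<close>. For hooks the Pieri rule itself does this: read as a recursion
  in the arm length, it produces all hook functions from the shifted elementary ones
  (\<open>hook_fun\<close>, \<open>shifted_schur_hook\<close>).

  For the generating function, $u / ((u-\frac12)\cdots(u-\frac{2p+1}2))$ equals the same expression
  with $p-1$ in place of \<open>p\<close> plus $\frac{2p+1}2$ times the original. So the coefficient of a basis
  term in \<open>u + v\<close> times the double sum is the left side of the Pieri rule, and the whole expression
  factors into $1 + \sum_p Fs_{(p|0)}/((u-\frac12)\cdots(u-\frac{2p+1}2))$ and the analogous series in \<open>v\<close> with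
  $Fs_{(0|q)}$ (\<open>double_newton_series_factorization\<close>). The first factor is $H(u)$ by the definition
  of \<open>\<phi>\<close> (\<open>H_ser_newton_series\<close>). The second is $E(v)$: at \<open>v = - u\<close> the double sum is multiplied
  by 0, so the second factor is inverse to $H(-v)$ (\<open>newton_series_inverse\<close>).
\<close>

section \<open>Determinants as functions of their columns\<close>

definition col_det :: "nat \<Rightarrow> (nat \<Rightarrow> nat \<Rightarrow> 'a::comm_ring_1) \<Rightarrow> 'a" where
  "col_det n c = det (mat n n (\<lambda>(i, j). c j i))"

lemma col_det_leibniz:
  "col_det n c = (\<Sum>\<sigma> | \<sigma> permutes {0..<n}. signof \<sigma> * (\<Prod>j<n. c j (\<sigma> j)))"
proof -
  have "col_det n c = (\<Sum>\<sigma> | \<sigma> permutes {0..<n}.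
      signof \<sigma> * (\<Prod>j<n. mat n n (\<lambda>(i, j). c j i) $$ (\<sigma> j, j)))"
    unfolding col_det_def by (rule det_col) simp
  also have "\<dots> = (\<Sum>\<sigma> | \<sigma> permutes {0..<n}. signof \<sigma> * (\<Prod>j<n. c j (\<sigma> j)))"
    by (intro sum.cong refl arg_cong2 [where f = "(*)"] prod.cong) auto
  finally show ?thesis .
qed

lemma col_det_cong:
  assumes "\<And>i j. i < n \<Longrightarrow> j < n \<Longrightarrow> c j i = d j i"
  shows "col_det n c = col_det n d"
  unfolding col_det_def by (rule arg_cong [where f = det], rule cong_mat) (use assms in auto)

lemma col_det_scale_rows:
  "(\<Prod>i<n. r i) * col_det n c = col_det n (\<lambda>j i. r i * c j i)"
proof -
  have "(\<Prod>i<n. r i) * (signof \<sigma> * (\<Prod>j<n. c j (\<sigma> j))) =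
      signof \<sigma> * (\<Prod>j<n. r (\<sigma> j) * c j (\<sigma> j))" if "\<sigma> permutes {0..<n}" for \<sigma>
  proof -
    have "(\<Prod>i<n. r i) = (\<Prod>j<n. r (\<sigma> j))"
      using prod.permute [OF that, of r] by (simp add: atLeast0LessThan o_def)
    then show ?thesis
      by (simp add: prod.distrib mult_ac)
  qed
  then show ?thesis
    unfolding col_det_leibniz sum_distrib_left by (intro sum.cong) auto
qed

lemma col_det_add_column:
  assumes "r < n"
  shows "col_det n (c(r := \<lambda>i. a i + t * b i)) = col_det n (c(r := a)) + t * col_det n (c(r := b))"
proof -
  have split: "(\<Prod>j<n. (c(r := d)) j (\<sigma> j)) = d (\<sigma> r) * (\<Prod>j\<in>{..<n} - {r}. c j (\<sigma> j))"
    for d \<sigma>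
    using assms by (subst prod.remove [of _ r]) (auto intro!: prod.cong)
  show ?thesis
    unfolding col_det_leibniz split by (simp add: sum_distrib_left sum.distrib algebra_simps)
qed

lemma col_det_equal_columns:
  assumes "j < n" "k < n" "j \<noteq> k" "c j = c k"
  shows "col_det n c = 0"
  unfolding col_det_def
  by (rule det_identical_columns [of _ n j k]) (use assms in \<open>auto intro!: eq_vecI\<close>)

text \<open>
  These columns interpolate between $g_{j-1} + c_j g_j$ for all $1 \<le> j \<le> r$ (\<open>s = r\<close>) and
  plain $g_{j-1}$ (\<open>s = 0\<close>); behind column \<open>r\<close> stands $g_j$. They arise because multiplying
  a column of falling powers by a linear factor gives the next falling power plus a multiple of
  the old one, and the next falling power already stands in the neighbouring column.
\<close>

definition mixed_columns ::
    "(nat \<Rightarrow> 'a) \<Rightarrow> (nat \<Rightarrow> nat \<Rightarrow> 'a) \<Rightarrow> (nat \<Rightarrow> 'a) \<Rightarrow> nat \<Rightarrow> nat \<Rightarrow> nat \<Rightarrow> nat \<Rightarrow> 'a::comm_ring_1"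
  where
  "mixed_columns v g c s r j =
     (if j = 0 then v
      else if j \<le> s then (\<lambda>i. g (j - 1) i + c j * g j i)
      else if j \<le> r then g (j - 1)
      else g j)"

text \<open>
  Since $g_s$ stands in column $s+1$, the multiple of $g_s$ in column \<open>s\<close> contributes a
  determinant with two equal columns. Once it is gone, column \<open>s\<close> equals $g_{s-1}$, which has
  the same effect on column $s-1$, and so on to the left.
\<close>

lemma mixed_columns_drop_multiples:
  assumes "s < r" "r < n"
  shows "col_det n (mixed_columns v g c s r) = col_det n (mixed_columns v g c 0 r)"
  using assms(1)
proof (induction s)
  case (Suc s)
  let ?c = "mixed_columns v g c s r"
  have upd: "mixed_columns v g c (Suc s) r = ?c(Suc s := \<lambda>i. g s i + c (Suc s) * g (Suc s) i)"
    "?c(Suc s := g s) = ?c"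
    using Suc.prems by (auto simp: mixed_columns_def fun_eq_iff)
  have "col_det n (?c(Suc s := g (Suc s))) = 0"
    by (rule col_det_equal_columns [of "Suc s" n "Suc (Suc s)"])
      (use Suc.prems assms in \<open>auto simp: mixed_columns_def\<close>)
  then have "col_det n (mixed_columns v g c (Suc s) r) = col_det n ?c"
    unfolding upd(1) using Suc.prems assms by (subst col_det_add_column) (auto simp: upd(2))
  with Suc show ?case by simp
qed simp

text \<open>
  Splitting the last composite column either raises it, and then all composite columns before it
  are raised as well by the previous lemma, or leaves $c_r g_r$, and the problem for
  $r-1$ remains. So only \<open>r + 1\<close> of the \<open>2 ^ r\<close> terms survive.
\<close>

lemma col_det_mixed_columns_expand:
  assumes "r < n"
  shows "col_det n (mixed_columns v g c r r) =
    (\<Sum>k\<le>r. (\<Prod>j\<in>{Suc k..r}. c j) * col_det n (mixed_columns v g c 0 k))"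
  using assms
proof (induction r)
  case (Suc r)
  let ?M = "mixed_columns v g c"
  have upd: "?M (Suc r) (Suc r) = (?M r r)(Suc r := \<lambda>i. g r i + c (Suc r) * g (Suc r) i)"
    "(?M r r)(Suc r := g r) = ?M r (Suc r)" "(?M r r)(Suc r := g (Suc r)) = ?M r r"
    by (auto simp: mixed_columns_def fun_eq_iff le_Suc_eq)
  have "col_det n (?M (Suc r) (Suc r)) =
      col_det n (?M 0 (Suc r)) + c (Suc r) * col_det n (?M r r)"
    unfolding upd(1) using Suc.prems mixed_columns_drop_multiples [of r "Suc r" n v g c]
    by (subst col_det_add_column) (auto simp: upd(2,3))
  also have "c (Suc r) * col_det n (?M r r) =
      (\<Sum>k\<le>r. (\<Prod>j\<in>{Suc k..Suc r}. c j) * col_det n (?M 0 k))"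
    using Suc by (simp add: sum_distrib_left mult_ac)
  finally show ?case by (simp add: add.commute)
qed simp

section \<open>The Pieri rule for alternants\<close>

lemma falling_Suc: "falling y (Suc m) = falling y m * (y - of_nat m)"
  by (simp add: falling_def)

lemma falling_linear_factor:
  "(y - w) * falling y m = falling y (Suc m) + (of_nat m - w) * falling y m"
  by (simp add: falling_Suc algebra_simps)

text \<open>
  Exponents $\mu_j + n - 1 - j$ (columns counted from 0) for the hook \<open>\<mu> = (p, 1, \<dots>, 1)\<close> with
  \<open>q\<close> ones, whose arm in the notation $(\cdot\,|\,q)$ is $p - 1$. Starting at \<open>p = 0\<close> includes the
  denominator (\<open>q = 0\<close>) in the family, so that the Pieri rule has one formula for all \<open>p\<close>.
\<close>

definition hook_exponents :: "nat \<Rightarrow> nat \<Rightarrow> nat \<Rightarrow> nat \<Rightarrow> nat" where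
  "hook_exponents n p q j = (if j = 0 then n - 1 + p else if j \<le> q then n - j else n - 1 - j)"

text \<open>
  The value 0 for \<open>q \<ge> n\<close> makes the Pieri rule hold for every \<open>n\<close>, also when a diagram has more
  than \<open>n\<close> rows.
\<close>

definition hook_alternant :: "nat \<Rightarrow> (nat \<Rightarrow> 'a::comm_ring_1) \<Rightarrow> nat \<Rightarrow> nat \<Rightarrow> 'a" where
  "hook_alternant n y p q =
     (if q < n then col_det n (\<lambda>j i. falling (y i) (hook_exponents n p q j)) else 0)"

text \<open>
  The polynomials $(u-k)(u-k-1)\cdots(u-n+1)$ are $u^{\downarrow n} / u^{\downarrow k}$: an expansion in
  them is an expansion in $1/u^{\downarrow k}$ with denominators cleared.
\<close>

definition newton_basis :: "nat \<Rightarrow> nat \<Rightarrow> 'a::comm_ring_1 \<Rightarrow> 'a" where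
  "newton_basis n k u = (\<Prod>j\<in>{k..<n}. u - of_nat j)"

lemma newton_basis_step:
  "k < n \<Longrightarrow> newton_basis n k u = (u - of_nat k) * newton_basis n (Suc k) u"
  by (simp add: newton_basis_def prod.atLeast_Suc_lessThan)

text \<open>
  For \<open>p = 0\<close> and a nonempty leg the exponent \<open>n - 1\<close> occurs in columns 0 and 1.
\<close>

lemma hook_alternant_0_Suc: "hook_alternant n y 0 (Suc q) = 0"
proof (cases "Suc q < n")
  case True
  then have "col_det n (\<lambda>j i. falling (y i) (hook_exponents n 0 (Suc q) j)) = 0"
    by (intro col_det_equal_columns [of 0 n 1]) (simp_all add: hook_exponents_def)
  then show ?thesis by (simp add: hook_alternant_def)
qed (simp add: hook_alternant_def)

text \<open>
  The product scales the rows of the alternant by \<open>u + y\<^sub>i - (n - 1)\<close>, which in every column turns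
  $y^{\downarrow e}$ into $y^{\downarrow (e+1)} + (e + u - n + 1)\, y^{\downarrow e}$. In the columns from 1 on these
  are the composite columns treated above, with coefficient \<open>u - j\<close> in column \<open>j\<close>; column 0 is
  split by linearity and gives the two hooks on the right.
\<close>

lemma hook_alternant_generating_function:
  fixes y :: "nat \<Rightarrow> 'a::comm_ring_1"
  assumes "n > 0"
  shows "(\<Prod>i<n. u + y i - of_nat (n - 1)) * hook_alternant n y p 0 =
    (\<Sum>q<n. newton_basis n (Suc q) u *
       (hook_alternant n y (Suc p) q + (u + of_nat p) * hook_alternant n y p q))"
proof -
  define f where "f = (\<lambda>e i. falling (y i) e)"
  define g where "g = (\<lambda>j. f (n - 1 - j))"
  define c where "c = (\<lambda>j. u - of_nat j)"
  define v where "v = (\<lambda>i. f (n + p) i + (u + of_nat p) * f (n - 1 + p) i)"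
  have factor: "(u + y i - of_nat (n - 1)) * f e i = f (Suc e) i + (of_nat e + u - of_nat (n - 1)) * f e i"
    for e i
    using falling_linear_factor [of "y i" "of_nat (n - 1) - u" e] by (simp add: f_def algebra_simps)
  have hook: "col_det n (mixed_columns (f (n - 1 + p')) g c 0 q) = hook_alternant n y p' q"
    if "q < n" for p' q
    using that unfolding hook_alternant_def
    by (auto intro!: col_det_cong simp: mixed_columns_def hook_exponents_def f_def g_def)
  have top: "col_det n (mixed_columns v g c 0 q) =
      hook_alternant n y (Suc p) q + (u + of_nat p) * hook_alternant n y p q" if "q < n" for q
  proof -
    have upd: "mixed_columns w g c 0 q = (mixed_columns v g c 0 q)(0 := w)" for w
      by (auto simp: mixed_columns_def fun_eq_iff)
    have "col_det n (mixed_columns v g c 0 q) =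
        col_det n (mixed_columns (f (n + p)) g c 0 q) +
        (u + of_nat p) * col_det n (mixed_columns (f (n - 1 + p)) g c 0 q)"
      unfolding upd [of "f _"] using assms
      by (subst col_det_add_column [symmetric]) (auto simp: v_def upd [of v, symmetric]
          intro!: arg_cong [where f = "col_det n"] simp: mixed_columns_def fun_eq_iff)
    then show ?thesis
      using hook [of q "Suc p"] hook [of q p] that assms by simp
  qed
  have "(\<Prod>i<n. u + y i - of_nat (n - 1)) * hook_alternant n y p 0 =
      col_det n (\<lambda>j i. (u + y i - of_nat (n - 1)) * f (hook_exponents n p 0 j) i)"
    using assms by (simp add: hook_alternant_def col_det_scale_rows f_def)
  also have "\<dots> = col_det n (mixed_columns v g c (n - 1) (n - 1))"
  proof (rule col_det_cong)
    fix i j assume "i < n" "j < n"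
    have "(of_nat (n - 1 - j) :: 'a) = of_nat (n - 1) - of_nat j"
      using \<open>j < n\<close> by (intro of_nat_diff) simp
    moreover have "Suc (n - Suc j) = n - 1 - (j - 1)" if "j > 0"
      using \<open>j < n\<close> that by simp
    ultimately show "(u + y i - of_nat (n - 1)) * f (hook_exponents n p 0 j) i =
        mixed_columns v g c (n - 1) (n - 1) j i"
      using \<open>j < n\<close> assms unfolding factor
      by (auto simp: mixed_columns_def hook_exponents_def v_def g_def c_def algebra_simps)
  qed
  also have "\<dots> = (\<Sum>q\<le>n - 1. (\<Prod>j\<in>{Suc q..n - 1}. c j) * col_det n (mixed_columns v g c 0 q))"
    using assms by (intro col_det_mixed_columns_expand) simp
  also have "\<dots> = (\<Sum>q<n. newton_basis n (Suc q) u * col_det n (mixed_columns v g c 0 q))"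
  proof -
    have "{..n - 1} = {..<n}" "{Suc q..n - 1} = {Suc q..<n}" for q
      using assms by auto
    then show ?thesis by (simp add: newton_basis_def c_def)
  qed
  finally show ?thesis by (simp add: top)
qed

text \<open>
  At \<open>u = k\<close> the basis polynomials with index at most \<open>k\<close> vanish and that with index \<open>Suc k\<close> does
  not, so the coefficients can be eliminated from the top down.
\<close>

lemma newton_basis_independent:
  fixes X :: "nat \<Rightarrow> 'a::{idom,ring_char_0}"
  assumes zero: "\<And>u. (\<Sum>k<n. X k * newton_basis n (Suc k) u) = 0" and "k < n"
  shows "X k = 0"
  using \<open>k < n\<close>
proof (induction k rule: measure_induct_rule [of "\<lambda>k. n - k"])
  case (less k)
  have other: "X j * newton_basis n (Suc j) (of_nat k) = 0" if "j < n" "j \<noteq> k" for j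
  proof (cases "j < k")
    case True
    then show ?thesis using less.prems
      by (auto simp: newton_basis_def prod_zero_iff)
  next
    case False
    then have "X j = 0" using that by (intro less.IH) auto
    then show ?thesis by simp
  qed
  then have "(\<Sum>j<n. X j * newton_basis n (Suc j) (of_nat k)) = X k * newton_basis n (Suc k) (of_nat k)"
    using less.prems other by (subst sum.remove [of _ k]) (auto intro!: sum.neutral simp del: mult_eq_0_iff)
  moreover have "newton_basis n (Suc k) (of_nat k) \<noteq> (0 :: 'a)"
    by (auto simp: newton_basis_def prod_zero_iff)
  ultimately show ?case
    using zero [of "of_nat k"] by simp
qed

text \<open>
  The shifted elementary polynomial
  $\sum_{i_1 < \cdots < i_k} (x_{i_1} + s + k - 1) \cdots (x_{i_{k-1}} + s + 1)(x_{i_k} + s)$ in the first \<open>n\<close>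
  variables, by the alternative whether the last variable occurs. The extra shift \<open>s\<close> is what
  the recursion needs; for \<open>s = 0\<close> every term with the last variable is divisible by it, which
  gives stability, and the bound \<open>k\<close> on the degree is visible, uniformly in \<open>n\<close>.
\<close>

fun shifted_e_poly :: "(nat \<Rightarrow> 'a::comm_ring_1) \<Rightarrow> nat \<Rightarrow> nat \<Rightarrow> nat \<Rightarrow> 'a" where
  "shifted_e_poly x s n 0 = 1"
| "shifted_e_poly x s 0 (Suc k) = 0"
| "shifted_e_poly x s (Suc n) (Suc k) =
     shifted_e_poly x s n (Suc k) + (x n + of_nat s) * shifted_e_poly x (Suc s) n k"

lemma shifted_e_poly_eq_0: "n < k \<Longrightarrow> shifted_e_poly x s n k = 0"
  by (induction x s n k rule: shifted_e_poly.induct) auto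

text \<open>
  The left side is symmetric in $x_i - i$. In the induction the new factor is split into
  \<open>u - n\<close>, which just extends the basis polynomials, and \<open>x\<^sub>n + s\<close>; for the latter \<open>u\<close> is
  replaced by \<open>u - 1\<close> and \<open>s\<close> by \<open>s + 1\<close>, which shifts the index of the basis.
\<close>

lemma shifted_e_poly_generating_function:
  "(\<Prod>i<n. u + x i + of_nat s - of_nat i) = (\<Sum>k\<le>n. shifted_e_poly x s n k * newton_basis n k u)"
proof (induction n arbitrary: s u)
  case 0
  then show ?case by (simp add: newton_basis_def)
next
  case (Suc n)
  have "(\<Prod>i<n. u + x i + of_nat s - of_nat i) = (\<Prod>i<n. (u - 1) + x i + of_nat (Suc s) - of_nat i)"
    by (simp add: algebra_simps)
  also have "\<dots> = (\<Sum>k\<le>n. shifted_e_poly x (Suc s) n k * newton_basis n k (u - 1))"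
    by (rule Suc.IH)
  also have "\<dots> = (\<Sum>k\<le>n. shifted_e_poly x (Suc s) n k * newton_basis (Suc n) (Suc k) u)"
    unfolding newton_basis_def
    by (subst prod.shift_bounds_Suc_ivl) (simp add: algebra_simps)
  finally have shift: "(\<Prod>i<n. u + x i + of_nat s - of_nat i) =
      (\<Sum>k\<le>n. shifted_e_poly x (Suc s) n k * newton_basis (Suc n) (Suc k) u)" .
  have "(\<Prod>i<Suc n. u + x i + of_nat s - of_nat i) =
      (\<Prod>i<n. u + x i + of_nat s - of_nat i) * (u - of_nat n) +
      (x n + of_nat s) * (\<Prod>i<n. u + x i + of_nat s - of_nat i)"
    by (simp add: algebra_simps)
  also have "(\<Prod>i<n. u + x i + of_nat s - of_nat i) * (u - of_nat n) =
      (\<Sum>k\<le>n. shifted_e_poly x s n k * newton_basis (Suc n) k u)"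
    unfolding Suc.IH sum_distrib_right
    by (intro sum.cong) (auto simp: newton_basis_def mult.assoc)
  also have "\<dots> = (\<Sum>k\<le>Suc n. shifted_e_poly x s n k * newton_basis (Suc n) k u)"
    by (simp add: shifted_e_poly_eq_0)
  also have "\<dots> = newton_basis (Suc n) 0 u +
      (\<Sum>k\<le>n. shifted_e_poly x s n (Suc k) * newton_basis (Suc n) (Suc k) u)"
    by (subst sum.atMost_Suc_shift) simp
  also have "(x n + of_nat s) * (\<Prod>i<n. u + x i + of_nat s - of_nat i) =
      (\<Sum>k\<le>n. (x n + of_nat s) * shifted_e_poly x (Suc s) n k * newton_basis (Suc n) (Suc k) u)"
    unfolding shift by (simp add: sum_distrib_left mult_ac)
  finally show ?case
    unfolding sum.atMost_Suc_shift [of _ n] by (simp add: sum.distrib algebra_simps)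
qed

lemma shifted_e_poly_unique:
  fixes x :: "nat \<Rightarrow> 'a::{idom,ring_char_0}"
  assumes "\<And>u. (\<Prod>i<n. u + x i - of_nat i) = newton_basis n 0 u + (\<Sum>k<n. c k * newton_basis n (Suc k) u)"
    and "k < n"
  shows "c k = shifted_e_poly x 0 n (Suc k)"
proof -
  have "(\<Sum>k\<le>n. shifted_e_poly x 0 n k * newton_basis n k u) =
      newton_basis n 0 u + (\<Sum>k<n. shifted_e_poly x 0 n (Suc k) * newton_basis n (Suc k) u)" for u
    by (subst sum.atMost_shift) simp
  then have "(\<Sum>k<n. (c k - shifted_e_poly x 0 n (Suc k)) * newton_basis n (Suc k) u) = 0" for u
    using assms(1) [of u] shifted_e_poly_generating_function [where x = x and s = 0 and u = u and n = n]
    by (simp add: left_diff_distrib sum_subtractf)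
  from newton_basis_independent [OF this \<open>k < n\<close>] show ?thesis by simp
qed

text \<open>
  Expanding the generating product once by the shifted elementary polynomials and once by its
  action on the columns, and comparing the coefficients of the Newton basis. For \<open>p = 0\<close> this says
  that the shifted elementary polynomials are quotients of alternants of one-column diagrams.
\<close>

lemma hook_alternant_pieri:
  fixes x :: "nat \<Rightarrow> 'a::{idom,ring_char_0}" and n :: nat
  defines "y \<equiv> \<lambda>i. x i + of_nat n - of_nat (i + 1)"
  shows "shifted_e_poly x 0 n (Suc q) * hook_alternant n y p 0 =
    hook_alternant n y (Suc p) q + hook_alternant n y p (Suc q) + of_nat (p + q) * hook_alternant n y p q"
proof (cases "q < n")
  case False
  then show ?thesis by (simp add: hook_alternant_def shifted_e_poly_eq_0)
next
  case True
  let ?e = "\<lambda>k. shifted_e_poly x 0 n k" and ?A = "hook_alternant n y"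
  define X where "X q = ?e (Suc q) * ?A p 0 - (?A (Suc p) q + ?A p (Suc q) + of_nat (p + q) * ?A p q)" for q
  have "X q = 0"
  proof (rule newton_basis_independent [OF _ True])
    fix u :: 'a
    have n: "n > 0" using True by simp
    have "(\<Prod>i<n. u + x i - of_nat i) = (\<Prod>i<n. u + y i - of_nat (n - 1))"
      using n by (intro prod.cong) (auto simp: y_def of_nat_diff)
    moreover have "(\<Prod>i<n. u + x i - of_nat i) =
        newton_basis n 0 u + (\<Sum>q<n. ?e (Suc q) * newton_basis n (Suc q) u)"
      using shifted_e_poly_generating_function [where x = x and s = 0 and u = u and n = n]
      by (subst (asm) sum.atMost_shift) simp
    ultimately have "(newton_basis n 0 u + (\<Sum>q<n. ?e (Suc q) * newton_basis n (Suc q) u)) * ?A p 0 =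
        (\<Sum>q<n. newton_basis n (Suc q) u * (?A (Suc p) q + (u + of_nat p) * ?A p q))"
      using hook_alternant_generating_function [OF n, of u y p] by simp
    also have "\<dots> = (\<Sum>q<n. newton_basis n (Suc q) u * (?A (Suc p) q + of_nat (p + q) * ?A p q) + newton_basis n q u * ?A p q)"
      by (intro sum.cong) (auto simp: newton_basis_step algebra_simps)
    also have "\<dots> = (\<Sum>q<n. newton_basis n (Suc q) u * (?A (Suc p) q + of_nat (p + q) * ?A p q))
        + (\<Sum>q<n. newton_basis n q u * ?A p q)"
      by (rule sum.distrib)
    also have "(\<Sum>q<n. newton_basis n q u * ?A p q) = (\<Sum>q\<le>n. newton_basis n q u * ?A p q)"
      by (simp add: lessThan_Suc_atMost [symmetric] hook_alternant_def)
    also have "\<dots> = newton_basis n 0 u * ?A p 0 + (\<Sum>q<n. newton_basis n (Suc q) u * ?A p (Suc q))"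
      by (rule sum.atMost_shift)
    finally have expansion: "(\<Sum>q<n. ?e (Suc q) * newton_basis n (Suc q) u) * ?A p 0 =
        (\<Sum>q<n. newton_basis n (Suc q) u * (?A (Suc p) q + of_nat (p + q) * ?A p q)) +
        (\<Sum>q<n. newton_basis n (Suc q) u * ?A p (Suc q))"
      by (simp add: distrib_right)
    have "(\<Sum>q<n. X q * newton_basis n (Suc q) u) =
        (\<Sum>q<n. ?e (Suc q) * newton_basis n (Suc q) u) * ?A p 0 -
        ((\<Sum>q<n. newton_basis n (Suc q) u * (?A (Suc p) q + of_nat (p + q) * ?A p q)) +
        (\<Sum>q<n. newton_basis n (Suc q) u * ?A p (Suc q)))"
      unfolding sum_distrib_right sum.distrib [symmetric] sum_subtractf [symmetric]
      by (intro sum.cong) (auto simp: X_def algebra_simps)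
    then show "(\<Sum>q<n. X q * newton_basis n (Suc q) u) = 0"
      by (simp add: expansion)
  qed
  then show ?thesis by (simp add: X_def)
qed

section \<open>Hook functions as elements of the algebra of shifted symmetric functions\<close>

lemma subst_var [simp]: "subst g (var i) = g i"
  by (simp add: var_def subst_single mon_subst_def)

lemma subst_diff: "subst g (f - h) = subst g f - subst g h"
  using subst_add [of g f "- h"] by (simp add: subst_uminus)

lemma subst_of_nat [simp]: "subst g (of_nat k) = of_nat k"
  by (induction k) (simp_all add: subst_add)

lemma subst_prod: "subst g (\<Prod>i\<in>I. f i) = (\<Prod>i\<in>I. subst g (f i))"
  by (induction I rule: infinite_finite_induct) (auto simp: subst_mult)

lemma comm_ring_hom_subst: "comm_ring_hom (subst g)"
  by standard (auto simp: subst_add subst_mult)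

lemma of_nat_eq_scal: "of_nat k = scal (of_nat k)"
  by (induction k) (simp_all add: scal_add)

lemma subst_shifted_e_poly:
  "subst g (shifted_e_poly x s n k) = shifted_e_poly (\<lambda>i. subst g (x i)) s n k"
  by (induction x s n k rule: shifted_e_poly.induct) (auto simp: subst_add subst_mult)

lemma shifted_e_poly_cong:
  "(\<And>i. i < n \<Longrightarrow> x i = y i) \<Longrightarrow> shifted_e_poly x s n k = shifted_e_poly y s n k"
  by (induction x s n k rule: shifted_e_poly.induct) auto

lemma shifted_e_poly_in_polys_in: "n \<le> N \<Longrightarrow> shifted_e_poly var s n k \<in> polys_in N"
proof (induction "var :: nat \<Rightarrow> cpoly" s n k rule: shifted_e_poly.induct)
  case (1 s n)
  then show ?case using polys_in_closed(1) [of 1] by simp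
next
  case (2 s k)
  then show ?case using polys_in_closed(1) [of 0] by simp
next
  case (3 s n k)
  have "var n \<in> polys_in N" using 3 by (simp add: polys_in_def var_def)
  moreover have "of_nat s \<in> polys_in N" by (simp add: of_nat_eq_scal polys_in_closed)
  ultimately show ?case using 3 by (auto intro!: polys_in_closed)
qed

lemma deg_le_shifted_e_poly: "deg_le k (shifted_e_poly var s n k)"
proof (induction "var :: nat \<Rightarrow> cpoly" s n k rule: shifted_e_poly.induct)
  case (1 s n)
  then show ?case using deg_le_closed(1) [of 1] by simp
next
  case (2 s k)
  then show ?case by (simp add: deg_le_def)
next
  case (3 s n k)
  have "deg_le 1 (var n)" by (simp add: deg_le_def var_def mon_deg_def)
  moreover have "deg_le 0 (of_nat s)" by (simp add: of_nat_eq_scal deg_le_closed(1))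
  ultimately have "deg_le 1 (var n + of_nat s)"
    using deg_le_closed(2) by fastforce
  then have "deg_le (1 + k) ((var n + of_nat s) * shifted_e_poly var (Suc s) n k)"
    using 3 by (intro deg_le_closed(3))
  then have "deg_le (max (Suc k) (1 + k)) (shifted_e_poly var s (Suc n) (Suc k))"
    unfolding shifted_e_poly.simps using 3 by (intro deg_le_closed(2))
  then show ?case by simp
qed

text \<open>
  The generating product is invariant under permutations of $x_i - i$, and it determines its
  Newton coefficients.
\<close>

lemma shifted_perm_shifted_e_poly:
  assumes "\<sigma> permutes {..<n}"
  shows "shifted_perm \<sigma> (shifted_e_poly var 0 n k) = shifted_e_poly var 0 n k"
proof (cases k)
  case 0
  then show ?thesis by (simp add: shifted_perm_def)
next
  case (Suc l)
  define x :: "nat \<Rightarrow> cpoly" where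
    "x = (\<lambda>j. var (\<sigma> j) - of_nat (\<sigma> j + 1) + of_nat (j + 1))"
  have image: "shifted_perm \<sigma> (shifted_e_poly var 0 n k) = shifted_e_poly x 0 n k"
    by (simp add: shifted_perm_def subst_shifted_e_poly x_def)
  show ?thesis
  proof (cases "l < n")
    case False
    then show ?thesis unfolding image by (simp add: Suc shifted_e_poly_eq_0)
  next
    case True
    have "shifted_e_poly x 0 n (Suc l) = shifted_e_poly var 0 n (Suc l)"
    proof (rule shifted_e_poly_unique [OF _ True])
      fix u :: cpoly
      have "(\<Prod>i<n. u + var i - of_nat i) = (\<Prod>j<n. u + var (\<sigma> j) - of_nat (\<sigma> j))"
        using prod.permute [OF assms, of "\<lambda>i. u + var i - of_nat i"] by (simp add: o_def)
      also have "\<dots> = (\<Prod>j<n. u + x j - of_nat j)"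
        by (simp add: x_def algebra_simps)
      also have "\<dots> = newton_basis n 0 u + (\<Sum>k<n. shifted_e_poly x 0 n (Suc k) * newton_basis n (Suc k) u)"
        using shifted_e_poly_generating_function [where x = x and s = 0 and u = u and n = n]
        by (subst (asm) sum.atMost_shift) simp
      finally show "(\<Prod>i<n. u + var i - of_nat i) =
          newton_basis n 0 u + (\<Sum>k<n. shifted_e_poly x 0 n (Suc k) * newton_basis n (Suc k) u)" .
    qed
    then show ?thesis using image by (simp only: Suc)
  qed
qed

lemma restrict_last_shifted_e_poly:
  "restrict_last n (shifted_e_poly var 0 (Suc n) k) = shifted_e_poly var 0 n k"
proof -
  have "restrict_last n (shifted_e_poly var 0 (Suc n) k) =
      shifted_e_poly (\<lambda>j. if j = n then 0 else var j) 0 (Suc n) k"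
    by (simp add: restrict_last_def subst_shifted_e_poly)
  also have "\<dots> = shifted_e_poly (\<lambda>j. if j = n then 0 else var j) 0 n k"
    by (cases k) auto
  also have "\<dots> = shifted_e_poly var 0 n k"
    by (rule shifted_e_poly_cong) simp
  finally show ?thesis .
qed

lift_definition shifted_e :: "nat \<Rightarrow> shifted_sym" is "\<lambda>k n. shifted_e_poly var 0 n k"
  using deg_le_shifted_e_poly
  by (auto simp: shifted_sym_polys_def shifted_e_poly_in_polys_in shifted_perm_shifted_e_poly
      restrict_last_shifted_e_poly)

text \<open>
  The Pieri rule for hooks, solved for the hook with the longest arm. It builds all hook functions
  from the elementary ones by ring operations alone, so that they lie in \<open>\<Lambda>\<^sup>*\<close> (divisibility,
  symmetry, stability, bounded degree) without further proof.
\<close>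

fun hook_fun :: "nat \<Rightarrow> nat \<Rightarrow> shifted_sym" where
  "hook_fun 0 q = shifted_e (Suc q)"
| "hook_fun (Suc p) q = shifted_e (Suc q) * hook_fun p 0 - hook_fun p (Suc q)
     - of_nat (p + q + 1) * hook_fun p q"

lemma hook_fun_pieri:
  "hook_fun (Suc p) q + hook_fun p (Suc q) + of_nat (p + q + 1) * hook_fun p q =
   hook_fun p 0 * hook_fun 0 q"
  by (simp add: algebra_simps)

lemma at_level_simps:
  "at_level (F + G) n = at_level F n + at_level G n"
  "at_level (F * G) n = at_level F n * at_level G n"
  "at_level (F - G) n = at_level F n - at_level G n"
  "at_level (of_nat k) n = of_nat k"
proof -
  show add: "at_level (F + G) n = at_level F n + at_level G n" for F G by transfer simp
  show "at_level (F * G) n = at_level F n * at_level G n" by transfer simp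
  have "at_level (- G) n = - at_level G n" by transfer simp
  then show "at_level (F - G) n = at_level F n - at_level G n"
    by (simp only: minus_shifted_sym_def add diff_conv_add_uminus)
  have "at_level 0 n = 0" "at_level 1 n = 1" by (transfer; simp)+
  then show "at_level (of_nat k) n = of_nat k"
    by (induction k) (simp_all add: add)
qed

definition shifted_points :: "nat \<Rightarrow> nat \<Rightarrow> cpoly" where
  "shifted_points n i = var i + of_nat n - of_nat (i + 1)"

lemma shifted_alternant_hook:
  assumes "q < n"
  shows "shifted_alternant n (hook p q) = hook_alternant n (shifted_points n) (Suc p) q"
proof -
  have "nth_default 0 (hook p q) j + n - (j + 1) = hook_exponents n (Suc p) q j"
    if "j < n" for j
    using that assms
    by (cases j) (auto simp: hook_def hook_exponents_def nth_default_def nth_Cons)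
  then have "shifted_alternant n (hook p q) =
      col_det n (\<lambda>j i. falling (shifted_points n i) (hook_exponents n (Suc p) q j))"
    unfolding shifted_alternant_def col_det_def
    by (intro arg_cong [where f = det] cong_mat) (auto simp: shifted_points_def)
  then show ?thesis using assms by (simp add: hook_alternant_def)
qed

lemma shifted_alternant_Nil:
  assumes "n > 0"
  shows "shifted_alternant n [] = hook_alternant n (shifted_points n) 0 0"
proof -
  have "shifted_alternant n [] =
      col_det n (\<lambda>j i. falling (shifted_points n i) (hook_exponents n 0 0 j))"
    unfolding shifted_alternant_def col_det_def
    by (intro arg_cong [where f = det] cong_mat)
      (auto simp: shifted_points_def hook_exponents_def nth_default_def)
  then show ?thesis using assms by (simp add: hook_alternant_def)
qed

text \<open>
  The alternants obey the recursion that defines \<open>hook_fun\<close>; cases with too few variables are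
  covered by the convention that the alternant is then 0.
\<close>

lemma hook_fun_alternant:
  "at_level (hook_fun p q) n * hook_alternant n (shifted_points n) 0 0 =
   hook_alternant n (shifted_points n) (Suc p) q"
proof (induction p arbitrary: q)
  case 0
  have "at_level (hook_fun 0 q) n = shifted_e_poly var 0 n (Suc q)"
    by (simp add: shifted_e.rep_eq)
  then show ?case
    using hook_alternant_pieri [of var n q 0]
    by (cases q) (simp_all add: hook_alternant_0_Suc shifted_points_def [abs_def])
next
  case (Suc p)
  let ?A = "hook_alternant n (shifted_points n)"
  have "at_level (hook_fun (Suc p) q) n * ?A 0 0 =
      shifted_e_poly var 0 n (Suc q) * (at_level (hook_fun p 0) n * ?A 0 0)
      - at_level (hook_fun p (Suc q)) n * ?A 0 0
      - of_nat (p + q + 1) * (at_level (hook_fun p q) n * ?A 0 0)"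
    unfolding hook_fun.simps at_level_simps shifted_e.rep_eq by (simp add: algebra_simps)
  also have "\<dots> = ?A (Suc (Suc p)) q"
    unfolding Suc.IH
    using hook_alternant_pieri [of var n q "Suc p"] by (simp add: shifted_points_def [abs_def])
  finally show ?case .
qed

lemma falling_of_nat_eq_0_iff:
  "falling (of_nat a :: 'a::{idom,ring_char_0}) b = 0 \<longleftrightarrow> a < b"
  by (auto simp: falling_def prod_zero_iff)

text \<open>
  At \<open>x = 0\<close> the matrix is upper triangular with factorials on the diagonal, because
  $a^{\downarrow b} = 0$ for naturals $a < b$.
\<close>

lemma shifted_alternant_Nil_nonzero: "shifted_alternant n [] \<noteq> 0"
proof -
  interpret comm_ring_hom "subst (\<lambda>_. 0)" by (rule comm_ring_hom_subst)
  let ?M = "mat n n (\<lambda>(i, j). falling (of_nat (n - Suc i)) (n - Suc j)) :: cpoly mat"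
  have point: "of_nat n - of_nat (i + 1) = (of_nat (n - Suc i) :: cpoly)" if "i < n" for i
    using that by (simp add: of_nat_diff)
  have "subst (\<lambda>_. 0) (shifted_alternant n []) = det ?M"
    unfolding shifted_alternant_def hom_det [symmetric]
    by (intro arg_cong [where f = det] eq_matI)
      (auto simp: falling_def subst_prod subst_diff subst_add nth_default_def point simp del: of_nat_Suc)
  also have "\<dots> = prod_list (diag_mat ?M)"
    by (rule det_upper_triangular [of _ n])
      (auto simp: upper_triangular_def falling_of_nat_eq_0_iff simp del: of_nat_diff)
  also have "\<dots> \<noteq> 0"
    by (auto simp: prod_list_zero_iff diag_mat_def falling_of_nat_eq_0_iff simp del: of_nat_diff)
  finally show ?thesis by auto
qed

lemma at_level_restrict: "restrict_last n (at_level F (Suc n)) = at_level F n"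
  by transfer simp

text \<open>
  Stability transports equality from many variables to fewer.
\<close>

lemma shifted_sym_eqI:
  assumes "\<And>n. n \<ge> N \<Longrightarrow> at_level F n = at_level G n"
  shows "F = G"
proof -
  have "at_level F n = at_level G n" for n
  proof (induction "N - n" arbitrary: n)
    case (Suc k)
    then have "at_level F (Suc n) = at_level G (Suc n)" by (intro Suc.hyps) simp
    then show ?case by (metis at_level_restrict)
  qed (use assms in simp)
  then show ?thesis by (simp add: at_level_inject [symmetric] fun_eq_iff)
qed

text \<open>
  This settles that the quotient of alternants defining a shifted Schur function exists in the
  case of hooks: \<open>hook_fun\<close> is a witness, and it is the only one because the ring of polynomials
  is a domain.
\<close>

lemma shifted_schur_hook: "shifted_schur (hook p q) = hook_fun p q"
  unfolding shifted_schur_def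
proof (rule the_equality)
  show quotient: "\<forall>n\<ge>length (hook p q).
      at_level (hook_fun p q) n * shifted_alternant n [] = shifted_alternant n (hook p q)"
  proof (intro allI impI)
    fix n assume "n \<ge> length (hook p q)"
    then have "q < n" by (simp add: hook_def)
    then show "at_level (hook_fun p q) n * shifted_alternant n [] = shifted_alternant n (hook p q)"
      by (simp add: shifted_alternant_hook shifted_alternant_Nil hook_fun_alternant)
  qed
  fix F
  assume "\<forall>n\<ge>length (hook p q).
      at_level F n * shifted_alternant n [] = shifted_alternant n (hook p q)"
  with quotient have "at_level F n * shifted_alternant n [] =
      at_level (hook_fun p q) n * shifted_alternant n []" if "n \<ge> length (hook p q)" for n
    using that by simp
  then show "F = hook_fun p q"
    by (intro shifted_sym_eqI [of "length (hook p q)"]) (simp add: shifted_alternant_Nil_nonzero)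
qed

section \<open>Newton series in the inverse variable\<close>

text \<open>
  $1/((u-c)(u-c-1)\cdots(u-c-k+1))$ as a series in $u^{-1}$; the case \<open>c = 0\<close> occurs in $H^*(u)$
  and $c = 1/2$ in the double series.
\<close>

definition inv_shifted_falling :: "'a::comm_ring_1 \<Rightarrow> nat \<Rightarrow> 'a fps" where
  "inv_shifted_falling c k = (\<Prod>j<k. inv_lin (of_nat j + c))"

lemma inv_shifted_falling_nth_0:
  "fps_nth (inv_shifted_falling c 0) i = (if i = 0 then 1 else 0)"
  by (simp add: inv_shifted_falling_def)

text \<open>
  The second equation says $u\, b_{k+1} = b_k + (k + c)\, b_{k+1}$ for the basis series $b_k$:
  multiplication by \<open>u\<close> shifts the coefficients of a series in $u^{-1}$.
\<close>

lemma inv_shifted_falling_nth_Suc: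
  "fps_nth (inv_shifted_falling c (Suc k)) 0 = 0"
  "fps_nth (inv_shifted_falling c (Suc k)) (Suc i) =
     fps_nth (inv_shifted_falling c k) i + (of_nat k + c) * fps_nth (inv_shifted_falling c (Suc k)) i"
proof -
  let ?B = "inv_shifted_falling c" and ?a = "of_nat k + c"
  show "fps_nth (?B (Suc k)) 0 = 0"
    by (simp add: inv_shifted_falling_def inv_lin_def)
  have "(1 - fps_const ?a * fps_X) * ?B (Suc k) =
      ?B k * ((1 - fps_const ?a * fps_X) * inv_lin ?a)"
    by (simp add: inv_shifted_falling_def mult_ac)
  then have "?B (Suc k) - fps_const ?a * (fps_X * ?B (Suc k)) = fps_X * ?B k"
    by (simp only: inv_lin_correct) (simp add: algebra_simps)
  from arg_cong [OF this, of "\<lambda>f. fps_nth f (Suc i)"]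
  show "fps_nth (?B (Suc k)) (Suc i) = fps_nth (?B k) i + ?a * fps_nth (?B (Suc k)) i"
    by (simp add: algebra_simps)
qed

lemma inv_shifted_falling_nth_eq_0: "i < k \<Longrightarrow> fps_nth (inv_shifted_falling c k) i = 0"
proof (induction i arbitrary: k)
  case 0
  then show ?case by (cases k) (simp_all add: inv_shifted_falling_nth_Suc)
next
  case (Suc i)
  then show ?case by (cases k) (simp_all add: inv_shifted_falling_nth_Suc)
qed

lemma inv_shifted_falling_nth_nonzero:
  "fps_nth (inv_shifted_falling c (Suc k)) i \<noteq> 0 \<Longrightarrow> k < i"
  by (rule ccontr) (simp add: inv_shifted_falling_nth_eq_0)

text \<open>
  $1 + \sum_{k \ge 0} a_k / ((u-c)\cdots(u-c-k))$, written coefficientwise, where the sum is finite.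
\<close>

definition newton_series :: "'a::comm_ring_1 \<Rightarrow> (nat \<Rightarrow> 'a) \<Rightarrow> 'a fps" where
  "newton_series c a = Abs_fps (\<lambda>n. (if n = 0 then 1 else 0) +
     (\<Sum>k<n. a k * fps_nth (inv_shifted_falling c (Suc k)) n))"

lemma newton_series_nth:
  assumes "n \<le> N"
  shows "fps_nth (newton_series c a) n = (if n = 0 then 1 else 0) +
     (\<Sum>k<N. a k * fps_nth (inv_shifted_falling c (Suc k)) n)"
proof -
  have "(\<Sum>k<n. a k * fps_nth (inv_shifted_falling c (Suc k)) n) =
      (\<Sum>k<N. a k * fps_nth (inv_shifted_falling c (Suc k)) n)"
    by (rule sum.mono_neutral_left) (use assms in \<open>auto simp: inv_shifted_falling_nth_eq_0\<close>)
  then show ?thesis by (simp add: newton_series_def)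
qed

lemma newton_series_nth_truncate:
  assumes "n \<le> N"
  shows "fps_nth (newton_series c a) n =
    fps_nth (1 + (\<Sum>k<N. fps_const (a k) * inv_shifted_falling c (Suc k))) n"
  using newton_series_nth [OF assms, of c a] by (simp add: fps_sum_nth)

lemma newton_series_limit:
  "1 + suminf (\<lambda>k. fps_const (a k) * inv_shifted_falling c (Suc k)) = newton_series c a"
proof -
  have "(\<lambda>k. fps_const (a k) * inv_shifted_falling c (Suc k)) sums (newton_series c a - 1)"
    unfolding sums_def
  proof (rule tendsto_fpsI)
    fix n
    show "eventually (\<lambda>N. fps_nth (\<Sum>k<N. fps_const (a k) * inv_shifted_falling c (Suc k)) n =
        fps_nth (newton_series c a - 1) n) sequentially"
      using eventually_ge_at_top [of n]
      by eventually_elim (simp add: newton_series_nth_truncate)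
  qed
  then show ?thesis by (simp add: sums_iff)
qed

text \<open>
  Substituting \<open>u - d\<close> for \<open>u\<close>: $1/((u-d)-c) = 1/(u-(c+d))$.
\<close>

lemma inv_lin_compose:
  fixes c d :: "'a::idom"
  shows "inv_lin c oo inv_lin d = inv_lin (c + d)"
proof -
  let ?l = "\<lambda>a :: 'a. 1 - fps_const a * fps_X" and ?f = "inv_lin c oo inv_lin d"
  have d0: "fps_nth (inv_lin d) 0 = 0" by (simp add: inv_lin_def)
  have "(?l c * inv_lin c) oo inv_lin d = inv_lin d"
    by (simp add: inv_lin_correct d0)
  then have "(1 - fps_const c * inv_lin d) * ?f = inv_lin d"
    by (simp add: fps_compose_mult_distrib [OF d0] fps_compose_sub_distrib d0)
  then have "?l d * ((1 - fps_const c * inv_lin d) * ?f) = fps_X"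
    by (simp add: inv_lin_correct)
  moreover have "?l d * (1 - fps_const c * inv_lin d) = ?l d - fps_const c * (?l d * inv_lin d)"
    by (simp add: algebra_simps)
  then have "?l d * (1 - fps_const c * inv_lin d) = ?l (c + d)"
    by (simp only: inv_lin_correct) (simp add: algebra_simps flip: fps_const_add)
  ultimately have "?l (c + d) * ?f = ?l (c + d) * inv_lin (c + d)"
    by (simp add: inv_lin_correct mult.assoc [symmetric])
  moreover have "?l (c + d) \<noteq> 0"
  proof
    assume "?l (c + d) = 0"
    then have "fps_nth (?l (c + d)) 0 = 0" by simp
    then show False by simp
  qed
  ultimately show ?thesis by simp
qed

lemma newton_series_compose_inv_lin:
  fixes c :: "'a::idom"
  shows "newton_series 0 a oo inv_lin c = newton_series c a"
proof (rule fps_ext)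
  fix n
  let ?S = "\<lambda>c. 1 + (\<Sum>k<n. fps_const (a k) * inv_shifted_falling c (Suc k))"
  have c0: "fps_nth (inv_lin c) 0 = 0" by (simp add: inv_lin_def)
  have basis: "inv_shifted_falling 0 m oo inv_lin c = inv_shifted_falling c m" for m
    by (simp add: inv_shifted_falling_def fps_compose_prod_distrib [OF c0] inv_lin_compose)
  have "fps_nth (newton_series 0 a oo inv_lin c) n = fps_nth (?S 0 oo inv_lin c) n"
    unfolding fps_compose_nth
  proof (rule sum.cong)
    fix i assume "i \<in> {0..n}"
    then show "fps_nth (newton_series 0 a) i * fps_nth (inv_lin c ^ i) n =
        fps_nth (?S 0) i * fps_nth (inv_lin c ^ i) n"
      using newton_series_nth_truncate [of i n 0 a] by simp
  qed simp
  also have "?S 0 oo inv_lin c = ?S c"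
    by (simp add: fps_compose_add_distrib fps_compose_sum_distrib
        fps_compose_mult_distrib [OF c0] basis)
  also have "fps_nth (?S c) n = fps_nth (newton_series c a) n"
    by (rule newton_series_nth_truncate [symmetric]) simp
  finally show "fps_nth (newton_series 0 a oo inv_lin c) n = fps_nth (newton_series c a) n" .
qed

lemma scal_half: "scal (1 / 2) + scal (1 / 2) = 1"
  by (simp flip: scal_add)

lemma inv_half_falling_eq: "inv_half_falling p = inv_shifted_falling (scal (1 / 2)) (Suc p)"
proof -
  have "scal (of_nat (2 * j + 1) / 2) = of_nat j + scal (1 / 2)" for j
    by (simp add: of_nat_eq_scal scal_add [symmetric] add_divide_distrib add.commute)
  then show ?thesis
    by (simp add: inv_half_falling_def inv_shifted_falling_def lessThan_Suc_atMost)
qed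

section \<open>The Pieri rule as an identity of series in two variables\<close>

definition double_newton_coeff ::
    "'a::comm_ring_1 \<Rightarrow> (nat \<Rightarrow> nat \<Rightarrow> 'a) \<Rightarrow> nat \<Rightarrow> nat \<Rightarrow> 'a" where
  "double_newton_coeff c F i j = (\<Sum>p<i. \<Sum>q<j.
     F p q * fps_nth (inv_shifted_falling c (Suc p)) i * fps_nth (inv_shifted_falling c (Suc q)) j)"

lemma double_newton_coeff_extend:
  assumes "i \<le> M" "j \<le> N"
  shows "double_newton_coeff c F i j = (\<Sum>p<M. \<Sum>q<N.
     F p q * fps_nth (inv_shifted_falling c (Suc p)) i * fps_nth (inv_shifted_falling c (Suc q)) j)"
proof -
  have "F p q * fps_nth (inv_shifted_falling c (Suc p)) i *
      fps_nth (inv_shifted_falling c (Suc q)) j = 0" if "\<not> (p < i \<and> q < j)" for p q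
    using that inv_shifted_falling_nth_eq_0 [of i "Suc p" c] inv_shifted_falling_nth_eq_0 [of j "Suc q" c]
    by auto
  then show ?thesis
    unfolding double_newton_coeff_def sum.cartesian_product
    by (intro sum.mono_neutral_left) (use assms in auto)
qed

lemma sum_shift_vanishing:
  fixes g :: "nat \<Rightarrow> 'a::comm_monoid_add"
  assumes "g N = 0"
  shows "(\<Sum>p<N. g p) = g 0 + (\<Sum>p<N. g (Suc p))"
  using assms sum.atMost_shift [of g N] by (simp add: lessThan_Suc_atMost [symmetric])

text \<open>
  Multiplying the term with index $(p,q)$ by \<open>u + v\<close> gives, by the two rules for multiplication by
  a variable, basis terms with indices $(p-1,q)$, $(p,q-1)$ and $(p,q)$, the last with coefficient
  $p+q+2c$. Collecting the coefficients of each basis term gives the left side of the Pieri rule,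
  plus boundary sums in one variable, which complete the products \<open>F p 0 * F 0 q\<close> to the product
  of two Newton series.
\<close>

lemma double_newton_series_factorization:
  fixes F :: "nat \<Rightarrow> nat \<Rightarrow> 'a::comm_ring_1"
  assumes pieri: "\<And>p q. F (Suc p) q + F p (Suc q) + (of_nat (p + q) + c + c) * F p q = F p 0 * F 0 q"
  shows "(if i = 0 \<and> j = 0 then 1 else 0) +
      (double_newton_coeff c F (Suc i) j + double_newton_coeff c F i (Suc j)) =
    fps_nth (newton_series c (\<lambda>p. F p 0)) i * fps_nth (newton_series c (F 0)) j"
proof -
  define b where "b = (\<lambda>k i. fps_nth (inv_shifted_falling c k) i)"
  \<comment> \<open>With this bound the truncated sums are exact, and the basis term of index \<open>N\<close> does not
      contribute, so index shifts leave no remainder.\<close>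
  define N where "N = Suc (i + j)"
  have b0: "b 0 k = (if k = 0 then 1 else 0)" for k
    by (simp add: b_def inv_shifted_falling_nth_0)
  have step: "b (Suc k) (Suc l) = b k l + (of_nat k + c) * b (Suc k) l" for k l
    by (simp add: b_def inv_shifted_falling_nth_Suc)
  have bN: "b N i = 0" "b N j = 0"
    by (simp_all add: b_def N_def inv_shifted_falling_nth_eq_0)
  have "double_newton_coeff c F (Suc i) j + double_newton_coeff c F i (Suc j) =
      (\<Sum>p<N. \<Sum>q<N. F p q * b (Suc p) (Suc i) * b (Suc q) j) +
      (\<Sum>p<N. \<Sum>q<N. F p q * b (Suc p) i * b (Suc q) (Suc j))"
    unfolding b_def by (subst (1 2) double_newton_coeff_extend [of _ N _ N]) (auto simp: N_def)
  also have "\<dots> = (\<Sum>p<N. \<Sum>q<N. F p q * b p i * b (Suc q) j) +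
      (\<Sum>p<N. \<Sum>q<N. F p q * b (Suc p) i * b q j) +
      (\<Sum>p<N. \<Sum>q<N. (of_nat (p + q) + c + c) * F p q * b (Suc p) i * b (Suc q) j)"
    unfolding step sum.distrib [symmetric]
    by (intro sum.cong refl) (simp add: algebra_simps)
  also have "(\<Sum>p<N. \<Sum>q<N. F p q * b p i * b (Suc q) j) =
      b 0 i * (\<Sum>q<N. F 0 q * b (Suc q) j) +
      (\<Sum>p<N. \<Sum>q<N. F (Suc p) q * b (Suc p) i * b (Suc q) j)"
    by (subst sum_shift_vanishing) (simp_all add: bN sum_distrib_left mult_ac)
  also have "(\<Sum>p<N. \<Sum>q<N. F p q * b (Suc p) i * b q j) =
      (\<Sum>p<N. F p 0 * b (Suc p) i) * b 0 j +
      (\<Sum>p<N. \<Sum>q<N. F p (Suc q) * b (Suc p) i * b (Suc q) j)"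
    by (subst sum_shift_vanishing) (simp_all add: bN sum_distrib_right sum.distrib)
  also have "b 0 i * (\<Sum>q<N. F 0 q * b (Suc q) j) +
        (\<Sum>p<N. \<Sum>q<N. F (Suc p) q * b (Suc p) i * b (Suc q) j) +
      ((\<Sum>p<N. F p 0 * b (Suc p) i) * b 0 j +
        (\<Sum>p<N. \<Sum>q<N. F p (Suc q) * b (Suc p) i * b (Suc q) j)) +
      (\<Sum>p<N. \<Sum>q<N. (of_nat (p + q) + c + c) * F p q * b (Suc p) i * b (Suc q) j) =
      b 0 i * (\<Sum>q<N. F 0 q * b (Suc q) j) + (\<Sum>p<N. F p 0 * b (Suc p) i) * b 0 j +
      (\<Sum>p<N. \<Sum>q<N. (F (Suc p) q + F p (Suc q) + (of_nat (p + q) + c + c) * F p q) *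
         b (Suc p) i * b (Suc q) j)"
    by (simp only: distrib_right sum.distrib add_ac)
  also have "(\<Sum>p<N. \<Sum>q<N. (F (Suc p) q + F p (Suc q) + (of_nat (p + q) + c + c) * F p q) *
         b (Suc p) i * b (Suc q) j) =
      (\<Sum>p<N. F p 0 * b (Suc p) i) * (\<Sum>q<N. F 0 q * b (Suc q) j)"
    unfolding pieri sum_product by (simp add: mult_ac)
  finally have sum: "double_newton_coeff c F (Suc i) j + double_newton_coeff c F i (Suc j) =
      b 0 i * (\<Sum>q<N. F 0 q * b (Suc q) j) + (\<Sum>p<N. F p 0 * b (Suc p) i) * b 0 j +
      (\<Sum>p<N. F p 0 * b (Suc p) i) * (\<Sum>q<N. F 0 q * b (Suc q) j)" .
  have "fps_nth (newton_series c (\<lambda>p. F p 0)) i = b 0 i + (\<Sum>p<N. F p 0 * b (Suc p) i)"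
    "fps_nth (newton_series c (F 0)) j = b 0 j + (\<Sum>q<N. F 0 q * b (Suc q) j)"
    by (simp_all add: newton_series_nth [of _ N] N_def b0) (simp_all add: b_def)
  then show ?thesis
    unfolding sum by (simp add: b0 algebra_simps)
qed

lemma double_newton_coeff_0:
  "double_newton_coeff c F 0 j = 0" "double_newton_coeff c F i 0 = 0"
  by (simp_all add: double_newton_coeff_def)

text \<open>
  Setting \<open>v = - u\<close> in \<open>u + v\<close> times a double series gives 0; here coefficientwise, as the
  alternating sum along an antidiagonal.
\<close>

lemma alternating_antidiagonal_telescope:
  fixes A :: "nat \<Rightarrow> nat \<Rightarrow> 'a::comm_ring_1"
  assumes "\<And>i. A i 0 = 0" "\<And>j. A 0 j = 0"
  shows "(\<Sum>i\<le>n. (-1) ^ i * (A (Suc i) (n - i) + A i (Suc (n - i)))) = 0"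
proof -
  have "(\<Sum>i\<le>m. (-1) ^ i * (A (Suc i) (n - i) + A i (Suc (n - i)))) =
      (-1) ^ m * A (Suc m) (n - m)" if "m \<le> n" for m
    using that
  proof (induction m)
    case (Suc m)
    then have "Suc (n - Suc m) = n - m" by simp
    with Suc show ?case by (simp add: algebra_simps)
  qed (simp add: assms)
  from this [of n] show ?thesis by (simp add: assms)
qed

text \<open>
  The factorization at \<open>v = - u\<close>: the double sum is killed by \<open>u + v = 0\<close>.
\<close>

lemma newton_series_inverse:
  fixes F :: "nat \<Rightarrow> nat \<Rightarrow> 'a::comm_ring_1"
  assumes pieri: "\<And>p q. F (Suc p) q + F p (Suc q) + (of_nat (p + q) + c + c) * F p q = F p 0 * F 0 q"
  shows "(newton_series c (\<lambda>p. F p 0) oo - fps_X) * newton_series c (F 0) = 1"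
proof (rule fps_ext)
  fix n
  let ?H = "newton_series c (\<lambda>p. F p 0)" and ?E = "newton_series c (F 0)"
  let ?A = "double_newton_coeff c F"
  have "fps_nth (?H oo - fps_X) i = (-1) ^ i * fps_nth ?H i" for i
    by (simp add: fps_compose_uminus')
  then have "fps_nth ((?H oo - fps_X) * ?E) n =
      (\<Sum>i\<le>n. (-1) ^ i * (fps_nth ?H i * fps_nth ?E (n - i)))"
    by (simp add: fps_mult_nth atMost_atLeast0 mult.assoc)
  also have "\<dots> = (\<Sum>i\<le>n. (-1) ^ i * ((if i = 0 \<and> n - i = 0 then 1 else 0) +
      (?A (Suc i) (n - i) + ?A i (Suc (n - i)))))"
    by (simp only: double_newton_series_factorization [where F = F and c = c, OF pieri])
  also have "\<dots> = (\<Sum>i\<le>n. if i = 0 \<and> n - i = 0 then 1 else 0)"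
  proof -
    have "(\<Sum>i\<le>n. (-1) ^ i * (?A (Suc i) (n - i) + ?A i (Suc (n - i)))) = 0"
      by (rule alternating_antidiagonal_telescope) (simp_all add: double_newton_coeff_0)
    then show ?thesis
      unfolding distrib_left [of "(-1) ^ _" "if _ then _ else _"] sum.distrib
      by (simp, intro sum.cong) auto
  qed
  also have "\<dots> = fps_nth 1 n"
    by (cases n) (auto intro!: sum.neutral)
  finally show "fps_nth ((?H oo - fps_X) * ?E) n = fps_nth 1 n" .
qed

lemma to_laurent_nth:
  "fls_nth (fls_nth (to_laurent f) j) i =
     (if j < 0 \<or> i < 0 then 0 else fps_nth (fps_nth f (nat j)) (nat i))"
  by (simp add: to_laurent_def)

text \<open>
  The first two hypotheses say that the product has no terms with a positive power of \<open>u\<close> or \<open>v\<close>.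
\<close>

lemma u_plus_v_times_to_laurent:
  fixes f g :: "'a::comm_ring_1 fps fps"
  assumes "\<And>j. fps_nth (fps_nth f j) 0 = 0" "\<And>i. fps_nth (fps_nth f 0) i = 0"
    and "\<And>i j. fps_nth (fps_nth g j) i =
      fps_nth (fps_nth f j) (Suc i) + fps_nth (fps_nth f (Suc j)) i"
  shows "(u_var + v_var) * to_laurent f = to_laurent g"
proof (intro fls_eqI)
  fix j i :: int
  have "fls_nth (fls_nth ((u_var + v_var) * to_laurent f) j) i =
      fls_nth (fls_nth (to_laurent f) j) (i + 1) + fls_nth (fls_nth (to_laurent f) (j + 1)) i"
    by (simp add: u_var_def v_var_def distrib_right fls_X_inv_times_conv_shift)
  moreover have "nat (k + 1) = Suc (nat k)" if "k \<ge> 0" for k :: int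
    using that by simp
  ultimately show "fls_nth (fls_nth ((u_var + v_var) * to_laurent f) j) i =
      fls_nth (fls_nth (to_laurent g) j) i"
    using assms by (cases "i < 0"; cases "j < 0") (auto simp: to_laurent_nth)
qed

section \<open>The hook identities for Frobenius--Schur functions\<close>

lemma algebra_iso_simps:
  assumes "algebra_iso \<phi>"
  shows "\<phi> (F + G) = \<phi> F + \<phi> G" "\<phi> (F * G) = \<phi> F * \<phi> G" "\<phi> 0 = 0" "\<phi> (of_nat k) = of_nat k"
    "\<phi> (\<Sum>i\<in>I. f i) = (\<Sum>i\<in>I. \<phi> (f i))"
proof -
  show add: "\<phi> (F + G) = \<phi> F + \<phi> G" for F G using assms by (simp add: algebra_iso_def)
  show "\<phi> (F * G) = \<phi> F * \<phi> G" using assms by (simp add: algebra_iso_def)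
  show zero: "\<phi> 0 = 0" using add [of 0 0] by simp
  have "shifted_scal 1 = 1" by transfer simp
  then have one: "\<phi> 1 = 1" using assms unfolding algebra_iso_def by (metis scal_1)
  show "\<phi> (of_nat k) = of_nat k" by (induction k) (simp_all add: add zero one)
  show "\<phi> (\<Sum>i\<in>I. f i) = (\<Sum>i\<in>I. \<phi> (f i))"
    by (induction I rule: infinite_finite_induct) (simp_all add: add zero)
qed

lemma Fs_hook_pieri:
  assumes "algebra_iso \<phi>"
  shows "Fs \<phi> (hook (Suc p) q) + Fs \<phi> (hook p (Suc q)) + of_nat (p + q + 1) * Fs \<phi> (hook p q) =
    Fs \<phi> (hook p 0) * Fs \<phi> (hook 0 q)"
  using arg_cong [OF hook_fun_pieri [of p q], of \<phi>]
  unfolding Fs_def shifted_schur_hook algebra_iso_simps [OF assms] .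

lemma algebra_iso_inv_shifted_falling_nth:
  assumes "algebra_iso \<phi>"
  shows "\<phi> (fps_nth (inv_shifted_falling 0 k) n) = fps_nth (inv_shifted_falling 0 k) n"
proof (induction n arbitrary: k)
  case 0
  then show ?case
    using algebra_iso_simps(3) [OF assms] algebra_iso_simps(4) [OF assms, of 1]
    by (cases k) (simp_all add: inv_shifted_falling_nth_0 inv_shifted_falling_nth_Suc)
next
  case (Suc n)
  then show ?case
    using algebra_iso_simps [OF assms]
    by (cases k) (simp_all add: inv_shifted_falling_nth_0 inv_shifted_falling_nth_Suc)
qed

text \<open>
  The hypothesis on \<open>\<phi>\<close>, with $u - 1/2$ substituted for \<open>u\<close>. The coefficients of
  $1/u^{\downarrow k}$ are integers and hence fixed by \<open>\<phi>\<close>.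
\<close>

lemma H_ser_newton_series:
  assumes "frobenius_schur_iso \<phi>"
  shows "H_ser = newton_series (scal (1 / 2)) (\<lambda>p. Fs \<phi> (hook p 0))"
proof -
  have iso: "algebra_iso \<phi>"
    and H: "Abs_fps (\<lambda>n. \<phi> (fps_nth Hstar_ser n)) = H_ser oo inv_lin (scal (- 1 / 2))"
    using assms by (simp_all add: frobenius_schur_iso_def)
  have one: "\<phi> 1 = 1" using algebra_iso_simps(4) [OF iso, of 1] by simp
  have "(inv_falling k :: shifted_sym fps) = inv_shifted_falling 0 k" for k
    by (simp add: inv_falling_def inv_shifted_falling_def)
  then have "Hstar_ser = newton_series 0 (\<lambda>k. shifted_schur (hook k 0))"
    unfolding newton_series_limit [symmetric] by (simp add: Hstar_ser_def shifted_h_def hook_def)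
  then have "Abs_fps (\<lambda>n. \<phi> (fps_nth Hstar_ser n)) = newton_series 0 (\<lambda>p. Fs \<phi> (hook p 0))"
    by (simp add: fps_eq_iff newton_series_def algebra_iso_simps [OF iso] one Fs_def
        algebra_iso_inv_shifted_falling_nth [OF iso])
  then have "H_ser oo inv_lin (scal (- 1 / 2)) oo inv_lin (scal (1 / 2)) =
      newton_series (scal (1 / 2)) (\<lambda>p. Fs \<phi> (hook p 0))"
    by (simp add: H newton_series_compose_inv_lin)
  moreover have "H_ser oo inv_lin (scal (- 1 / 2)) oo inv_lin (scal (1 / 2)) =
      H_ser oo (inv_lin (scal (- 1 / 2)) oo inv_lin (scal (1 / 2)))"
    by (rule fps_compose_assoc [symmetric]) (simp_all add: inv_lin_def)
  moreover have "inv_lin (scal (- 1 / 2)) oo inv_lin (scal (1 / 2)) = fps_X"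
    using inv_lin_correct [of "0 :: cpoly"] by (simp add: inv_lin_compose flip: scal_add)
  ultimately show ?thesis by simp
qed

lemma E_ser_eqI:
  assumes "(H_ser oo - fps_X) * f = 1"
  shows "E_ser = f"
proof -
  have "fps_nth H_ser 0 = 1" by (simp add: H_ser_def)
  then have "(H_ser oo - fps_X) * E_ser = 1"
    unfolding E_ser_def by (intro fps_right_inverse) simp
  then have "f = f * ((H_ser oo - fps_X) * E_ser)" by simp
  also have "\<dots> = ((H_ser oo - fps_X) * f) * E_ser" by (simp only: mult_ac)
  finally show ?thesis using assms by simp
qed

lemma double_sum_hook_term_nth:
  "fps_nth (fps_nth (double_sum (hook_term \<phi>)) j) i =
     double_newton_coeff (scal (1 / 2)) (\<lambda>p q. Fs \<phi> (hook p q)) i j"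
proof -
  let ?t = "\<lambda>(p, q). fps_nth (fps_nth (hook_term \<phi> p q) j) i"
  have "Sum_any ?t = sum ?t ({..<i} \<times> {..<j})"
    by (rule Sum_any.expand_superset)
      (auto simp: hook_term_nth inv_half_falling_eq dest: inv_shifted_falling_nth_nonzero)
  also have "\<dots> = double_newton_coeff (scal (1 / 2)) (\<lambda>p q. Fs \<phi> (hook p q)) i j"
    by (simp add: double_newton_coeff_def sum.cartesian_product hook_term_nth inv_half_falling_eq)
  finally show ?thesis by (simp add: double_sum_def)
qed

theorem theorem2p3:
  fixes \<phi> :: "shifted_sym \<Rightarrow> cpoly"
  assumes "frobenius_schur_iso \<phi>"
  shows "1 + (u_var + v_var) * to_laurent (double_sum (hook_term \<phi>)) =
           to_laurent (in_u H_ser * in_v E_ser)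
       \<and> (\<forall>p q. Fs \<phi> (hook (p + 1) q) + Fs \<phi> (hook p (q + 1))
             + of_nat (p + q + 1) * Fs \<phi> (hook p q)
           = Fs \<phi> (hook p 0) * Fs \<phi> (hook 0 q))"
proof (intro conjI allI)
  have iso: "algebra_iso \<phi>" using assms by (simp add: frobenius_schur_iso_def)
  show "Fs \<phi> (hook (p + 1) q) + Fs \<phi> (hook p (q + 1)) + of_nat (p + q + 1) * Fs \<phi> (hook p q)
      = Fs \<phi> (hook p 0) * Fs \<phi> (hook 0 q)" for p q
    using Fs_hook_pieri [OF iso] by simp
  \<comment> \<open>The half-integer shift turns $p + q + 2c$ into the coefficient \<open>p + q + 1\<close> of the Pieri rule.\<close>
  define c where "c = scal (1 / 2)"
  define F where "F = (\<lambda>p q. Fs \<phi> (hook p q))"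
  have pieri: "F (Suc p) q + F p (Suc q) + (of_nat (p + q) + c + c) * F p q = F p 0 * F 0 q" for p q
    using Fs_hook_pieri [OF iso, of p q] scal_half by (simp add: F_def c_def add.assoc add_ac)
  have H: "H_ser = newton_series c (\<lambda>p. F p 0)"
    using H_ser_newton_series [OF assms] by (simp add: F_def c_def)
  have E: "E_ser = newton_series c (F 0)"
    by (rule E_ser_eqI) (simp add: H newton_series_inverse [where F = F, OF pieri])
  define A where "A = double_sum (hook_term \<phi>)"
  have A: "fps_nth (fps_nth A j) i = double_newton_coeff c F i j" for i j
    by (simp add: A_def double_sum_hook_term_nth F_def c_def)
  have "(u_var + v_var) * to_laurent A = to_laurent (in_u H_ser * in_v E_ser - 1)"
  proof (rule u_plus_v_times_to_laurent)
    fix i j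
    have "fps_nth (fps_nth (1 :: cpoly fps fps) j) i = (if i = 0 \<and> j = 0 then 1 else 0)"
      by simp
    then show "fps_nth (fps_nth (in_u H_ser * in_v E_ser - 1) j) i =
        fps_nth (fps_nth A j) (Suc i) + fps_nth (fps_nth A (Suc j)) i"
      using double_newton_series_factorization [where F = F and c = c and i = i and j = j, OF pieri]
      by (simp add: in_u_def in_v_def A H E algebra_simps)
  qed (simp_all add: A double_newton_coeff_0)
  moreover have "to_laurent (in_u H_ser * in_v E_ser) = 1 + to_laurent (in_u H_ser * in_v E_ser - 1)"
    by (intro fls_eqI) (auto simp: to_laurent_nth)
  ultimately show "1 + (u_var + v_var) * to_laurent (double_sum (hook_term \<phi>)) =
      to_laurent (in_u H_ser * in_v E_ser)"
    by (simp add: A_def)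
qed

end
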